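(* Consider the energy consumption game $\mathcal{G}=(\mathcal{N},\mathcal{X},(b_n^{\mathrm{HP}})_{n\in\mathcal{N}})$ with hourly proportional billing described in the context. For $h\in\mathcal{H}$ let $c_h(\ell^h):=\frac{1}{\ell^h}C_h(\ell^h)$ be the per-unit price of electricity. If $c_h'\ge 0$ (for the time periods $h\in\mathcal{H}$), i.e. prices are increasing with the global load, then a Nash equilibrium exists. If, in addition, $$\forall h\in\mathcal{H},\qquad \frac{(\ell^h)^2}{\sum_{n\in\mathcal{N}}(\ell_n^h)^2}>\left(\frac{\ell^h\,c_h''(\ell^h)}{2\,c_h'(\ell^h)}\right)^2,$$ then the Nash equilibrium is unique.
   Context: $\mathcal{N}$ is a set of $N$ electricity consumers (the players) and $\mathcal{H}$ is the set of time periods considered over a day. Each user $n\in\mathcal{N}$ has a set $\mathcal{A}_n$ of electric appliances and sets the power $x_{na}^h$ allowed to each appliance $a\in\mathcal{A}_n$ at each time period $h\in\mathcal{H}$. The set $\mathcal{X}_n$ of feasible strategies of user $n$ is the set of vectors $\bm{x}_n=(x_{na}^h)_{h\in\mathcal{H},a\in\mathcal{A}_n}$ satisfying $$\sum_{h\in\mathcal{H}}x_{na}^h=E_{na}\ \ \forall a\in\mathcal{A}_n,\qquad \underline{x}_{na}^h\le x_{na}^h\le\overline{x}_{na}^h\ \ \forall a\in\mathcal{A}_n,\ \forall h\in\mathcal{H},$$ where $E_{na}$ is the fixed daily amount of energy required by appliance $a$ of user $n$, and $\underline{x}_{na}^h,\overline{x}_{na}^h$ are given lower and upper power bounds (with $\underline{x}_{na}^h=\overline{x}_{na}^h=0$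 if the appliance cannot be used in period $h$). The set of pure strategy profiles is $\mathcal{X}=\prod_{n\in\mathcal{N}}\mathcal{X}_n$, and $\bm{x}_{-n}=(\bm{x}_m)_{m\ne n}$ denotes the strategies of all users but $n$. For a profile $\bm{x}\in\mathcal{X}$, the load of user $n$ at time $h$ is $\ell_n^h=\sum_{a\in\mathcal{A}_n}x_{na}^h$, and the total load at time $h$ is $\ell^h=\sum_{n\in\mathcal{N}}\ell_n^h$. For each $h\in\mathcal{H}$, $C_h(\ell^h)$ is the system cost of providing the total load $\ell^h$ at time $h$; the functions $C_h$ are assumed increasing and strictly convex. Primes denote derivatives with respect to the total load. Under hourly proportional (HP) billing, user $n$ pays $$b_n^{\mathrm{HP}}(\bm{x}_n,\bm{x}_{-n})=\sum_{h\in\mathcal{H}}\frac{\ell_n^h}{\sum_{m\in\mathcal{N}}\ell_m^h}\,C_h(\ell^h),$$ and each user $n$ seeks to minimize $b_n^{\mathrm{HP}}(\bm{x}_n,\bm{x}_{-n})$ over $\bm{x}_n\in\mathcal{X}_n$. A Nash equilibrium is a profile $\bm{x}\in\mathcal{X}$ such that, for every $n\in\mathcal{N}$ and every $\bm{y}_n\in\mathcal{X}_n$, $b_n^{\mathrm{HP}}(\bm{x}_n,\bm{x}_{-n})\le b_n^{\mathrm{HP}}(\bm{y}_n,\bm{x}_{-n})$.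
   Formalization: Uniqueness is proved for the user loads, and for the full profile if each user has at most one appliance, as several appliances can trade power at equal load. Power bounds are nonnegative, strategy sets nonempty; C_h(0)=0 is assumed where zero total load is feasible (bill is 0/0). *)

theory Defs
  imports "HOL-Analysis.Analysis"
begin

text \<open>
  Users range over a finite type \<open>'n\<close>, time periods over a finite type \<open>'h\<close>; user \<open>n\<close> owns the
  finite set of appliances \<open>A n :: 'a set\<close>.  A profile is \<open>x :: 'n \<Rightarrow> 'a \<Rightarrow> 'h \<Rightarrow> real\<close>, with
  \<open>x n a h\<close> the power of appliance \<open>a\<close> of user \<open>n\<close> in period \<open>h\<close>.
\<close>

definition strictly_convex_on :: "real set \<Rightarrow> (real \<Rightarrow> real) \<Rightarrow> bool" where
  "strictly_convex_on S f \<longleftrightarrow> convex S \<and>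
     (\<forall>x\<in>S. \<forall>y\<in>S. \<forall>u>0. \<forall>v>0. x \<noteq> y \<and> u + v = 1 \<longrightarrow>
        f (u * x + v * y) < u * f x + v * f y)"

text \<open>
  The strategies of user \<open>n\<close> are vectors indexed by \<open>A n\<close> and the periods.  The last conjunct fixes
  the irrelevant values outside \<open>A n\<close>, so that equality of functions is equality of these vectors.
\<close>

definition strategy_set ::
  "('n \<Rightarrow> 'a set) \<Rightarrow> ('n \<Rightarrow> 'a \<Rightarrow> real) \<Rightarrow> ('n \<Rightarrow> 'a \<Rightarrow> 'h \<Rightarrow> real) \<Rightarrow> ('n \<Rightarrow> 'a \<Rightarrow> 'h \<Rightarrow> real)
    \<Rightarrow> 'n \<Rightarrow> ('a \<Rightarrow> 'h::finite \<Rightarrow> real) set" where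
  "strategy_set A E lo hi n =
     {y. (\<forall>a\<in>A n. (\<Sum>h\<in>UNIV. y a h) = E n a) \<and>
         (\<forall>a\<in>A n. \<forall>h. lo n a h \<le> y a h \<and> y a h \<le> hi n a h) \<and>
         (\<forall>a. a \<notin> A n \<longrightarrow> (\<forall>h. y a h = 0))}"

definition profile_set ::
  "('n \<Rightarrow> 'a set) \<Rightarrow> ('n \<Rightarrow> 'a \<Rightarrow> real) \<Rightarrow> ('n \<Rightarrow> 'a \<Rightarrow> 'h \<Rightarrow> real) \<Rightarrow> ('n \<Rightarrow> 'a \<Rightarrow> 'h \<Rightarrow> real)
    \<Rightarrow> ('n \<Rightarrow> 'a \<Rightarrow> 'h::finite \<Rightarrow> real) set" where
  "profile_set A E lo hi = {x. \<forall>n. x n \<in> strategy_set A E lo hi n}"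

definition user_load ::
  "('n \<Rightarrow> 'a set) \<Rightarrow> ('n \<Rightarrow> 'a \<Rightarrow> 'h \<Rightarrow> real) \<Rightarrow> 'n \<Rightarrow> 'h \<Rightarrow> real" where
  "user_load A x n h = (\<Sum>a\<in>A n. x n a h)"

definition total_load ::
  "('n::finite \<Rightarrow> 'a set) \<Rightarrow> ('n \<Rightarrow> 'a \<Rightarrow> 'h \<Rightarrow> real) \<Rightarrow> 'h \<Rightarrow> real" where
  "total_load A x h = (\<Sum>n\<in>UNIV. user_load A x n h)"

text \<open>
  In a period with zero total load the quotient below is \<open>0 / 0 = 0\<close>, i.e. nobody is charged.
\<close>

definition bill_HP ::
  "('n::finite \<Rightarrow> 'a set) \<Rightarrow> ('h::finite \<Rightarrow> real \<Rightarrow> real) \<Rightarrow> 'n \<Rightarrow> ('n \<Rightarrow> 'a \<Rightarrow> 'h \<Rightarrow> real) \<Rightarrow> real" where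
  "bill_HP A C n x =
     (\<Sum>h\<in>UNIV. user_load A x n h / (\<Sum>m\<in>UNIV. user_load A x m h) * C h (total_load A x h))"

definition nash_equilibrium ::
  "('n::finite \<Rightarrow> 'a set) \<Rightarrow> ('n \<Rightarrow> 'a \<Rightarrow> real) \<Rightarrow> ('n \<Rightarrow> 'a \<Rightarrow> 'h \<Rightarrow> real) \<Rightarrow> ('n \<Rightarrow> 'a \<Rightarrow> 'h \<Rightarrow> real)
    \<Rightarrow> ('h::finite \<Rightarrow> real \<Rightarrow> real) \<Rightarrow> ('n \<Rightarrow> 'a \<Rightarrow> 'h \<Rightarrow> real) \<Rightarrow> bool" where
  "nash_equilibrium A E lo hi C x \<longleftrightarrow>
     x \<in> profile_set A E lo hi \<and>
     (\<forall>n. \<forall>y\<in>strategy_set A E lo hi n. bill_HP A C n x \<le> bill_HP A C n (x(n := y)))"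

definition unit_price :: "('h \<Rightarrow> real \<Rightarrow> real) \<Rightarrow> 'h \<Rightarrow> real \<Rightarrow> real" where
  "unit_price C h l = 1 / l * C h l"

end

theory Submission
  imports Defs
begin

text \<open>
  The bill of a user depends on the strategies only through the loads, so the game is transported to
  vectors of loads (\<open>load_game\<close>), where each user chooses a point of a compact convex set.

  \<^bold>\<open>Existence.\<close>  With increasing unit price and convex cost, the bill of a user is convex in the user's
  own load (\<open>cost_share_convex\<close>): splitting a convex cost in proportion to the loads loses convexity
  only through the price, which moves in the right direction.  The bill is also continuous, even at
  zero total load, where the cost vanishes (\<open>continuous_on_cost_share\<close>).  A game with
  compact convex strategy sets and continuous bills, each convex in the own strategy, has an
  equilibrium.  This is derived from Brouwer's theorem for a proximal best-reply map
  (\<open>ex_self_minimizer\<close>).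

  \<^bold>\<open>Uniqueness.\<close>  The argument is Rosen's.  An equilibrium satisfies a first-order condition, namely
  that no user's bill starts to decrease when that user moves towards another feasible profile
  (\<open>equilibrium_imp_marginal_nonneg\<close>).  Adding these conditions for two equilibria moving towards each
  other contradicts the strict monotonicity of the vector of marginal bills \<open>c l + l\<^sub>n c' l\<close>.
  This monotonicity can be checked period by period (\<open>marginal_sum_neg\<close>), and it amounts to
  positivity of the quadratic form of the Jacobian (\<open>marginal_form_pos\<close>).  The bound on the ratio of
  \<open>l\<^sup>2\<close> to the sum of the \<open>l\<^sub>n\<^sup>2\<close> is the condition under which Cauchy--Schwarz gives this positivity.
  Periods in which the total load vanishes at one of the equilibria, where the unit
  price is meaningless, are handled separately (\<open>marginal_sum_neg_idle\<close>).
\<close>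

section \<open>Costs shared in proportion to loads\<close>

definition cost_share :: "(real \<Rightarrow> real) \<Rightarrow> real \<Rightarrow> real \<Rightarrow> real" where
  "cost_share f a l = a / l * f l"

lemma strictly_convex_on_leD:
  assumes "strictly_convex_on S f" "x \<in> S" "y \<in> S" "0 \<le> u" "0 \<le> v" "u + v = 1"
  shows "f (u * x + v * y) \<le> u * f x + v * f y"
proof (cases "u = 0 \<or> v = 0 \<or> x = y")
  case True
  then show ?thesis using assms(6)
    by (auto simp flip: distrib_right)
next
  case False
  then show ?thesis using assms unfolding strictly_convex_on_def by (smt (verit))
qed

lemma cost_share_self:
  assumes "l = 0 \<Longrightarrow> f 0 = 0"
  shows "cost_share f l l = f l"
  using assms by (cases "l = 0") (auto simp: cost_share_def)

text \<open>
  Let the other users consume \<open>s\<close> in total.  With \<open>t = u a + v b\<close>, bounding \<open>f (s + t)\<close> by the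
  convexity of \<open>f\<close> in the share of a user with load \<open>t\<close> leaves, for \<open>s > 0\<close>, the slack
  \<open>s u v (b - a) (q - p) / (s + t)\<close>, where \<open>p\<close> and \<open>q\<close> are the unit prices at the two ends, and
  this is nonnegative because the unit price is monotone.  The hypothesis \<open>f 0 = 0\<close> at zero total load
  is what makes the value \<open>0 / 0 = 0\<close> of the share fit the convex graph.
\<close>

lemma cost_share_convex:
  fixes f :: "real \<Rightarrow> real"
  assumes conv: "strictly_convex_on {0..} f"
    and nonneg: "0 \<le> s" "0 \<le> a" "0 \<le> b"
    and uv: "0 < u" "0 < v" "u + v = 1"
    and price_mono: "\<lbrakk>0 < s + a; 0 < s + b\<rbrakk> \<Longrightarrow>
      0 \<le> (b - a) * (f (s + b) / (s + b) - f (s + a) / (s + a))"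
    and zero: "s + a = 0 \<or> s + b = 0 \<Longrightarrow> f 0 = 0"
  shows "cost_share f (u * a + v * b) (s + (u * a + v * b))
    \<le> u * cost_share f a (s + a) + v * cost_share f b (s + b)"
proof -
  define t where "t = u * a + v * b"
  have t0: "0 \<le> t" using nonneg uv by (simp add: t_def)
  show ?thesis
  proof (cases "s = 0")
    case True
    have *: "f t \<le> u * f a + v * f b"
      unfolding t_def using strictly_convex_on_leD[OF conv, of a b u v] nonneg uv by auto
    have "t = 0 \<Longrightarrow> a = 0"
      using nonneg uv unfolding t_def by (simp add: add_nonneg_eq_0_iff)
    then have "cost_share f t t = f t" using zero True by (intro cost_share_self) auto
    moreover have "cost_share f a a = f a" "cost_share f b b = f b"
      using zero True by (auto intro!: cost_share_self)
    ultimately show ?thesis using True * by (simp add: t_def)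
  next
    case False
    then have pos: "0 < s" "0 < s + a" "0 < s + b" "0 < s + t" using nonneg t0 by auto
    define p where "p = f (s + a) / (s + a)"
    define q where "q = f (s + b) / (s + b)"
    have fa: "f (s + a) = (s + a) * p" and fb: "f (s + b) = (s + b) * q"
      using pos by (auto simp: p_def q_def)
    have st: "s + t = u * (s + a) + v * (s + b)"
      unfolding t_def using uv(3) by algebra
    have "f (s + t) \<le> u * ((s + a) * p) + v * ((s + b) * q)"
      using strictly_convex_on_leD[OF conv, of "s+a" "s+b" u v] pos uv
      by (simp add: fa fb st)
    then have "t * f (s + t) \<le> t * (u * ((s + a) * p) + v * ((s + b) * q))"
      using t0 by (rule mult_left_mono)
    moreover have "(s + t) * (u * (a * p) + v * (b * q)) - t * (u * ((s + a) * p) + v * ((s + b) * q))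
        = s * u * v * ((b - a) * (q - p))"
      unfolding t_def using uv(3) by algebra
    moreover have "0 \<le> s * u * v * ((b - a) * (q - p))"
      using pos uv price_mono unfolding p_def q_def by simp
    ultimately have "t * f (s + t) \<le> (s + t) * (u * (a * p) + v * (b * q))" by linarith
    then have "t / (s + t) * f (s + t) \<le> u * (a * p) + v * (b * q)"
      using pos by (simp add: field_simps)
    then show ?thesis by (simp add: cost_share_def p_def q_def t_def)
  qed
qed

text \<open>
  The only delicate points are those with zero total load, where \<open>a / l\<close> has no limit.  There
  monotonicity and convexity together with \<open>f 0 = 0\<close> squeeze the share between \<open>0\<close> and
  \<open>l \<cdot> f 1\<close>, so it tends to \<open>0\<close> no matter how the load is divided.
\<close>

lemma continuous_on_cost_share:
  fixes a l :: "'b::metric_space \<Rightarrow> real"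
  assumes cont: "continuous_on S a" "continuous_on S l"
    and bounds: "\<And>x. x \<in> S \<Longrightarrow> 0 \<le> a x \<and> a x \<le> l x"
    and mono: "mono_on {0..} f" and conv: "strictly_convex_on {0..} f"
    and isCont: "\<And>r. 0 < r \<Longrightarrow> isCont f r"
    and zero: "\<And>x. x \<in> S \<Longrightarrow> l x = 0 \<Longrightarrow> f 0 = 0"
  shows "continuous_on S (\<lambda>x. cost_share f (a x) (l x))"
  unfolding continuous_on_eq_continuous_within
proof
  fix x assume x: "x \<in> S"
  have ca: "continuous (at x within S) a" and cl: "continuous (at x within S) l"
    using cont x by (auto simp: continuous_on_eq_continuous_within)
  show "continuous (at x within S) (\<lambda>x. cost_share f (a x) (l x))"
  proof (cases "l x = 0")
    case False
    then have "0 < l x" using bounds[OF x] by linarith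
    then have "continuous (at x within S) (\<lambda>x. f (l x))"
      using continuous_within_compose3[OF isCont cl] by blast
    then show ?thesis unfolding cost_share_def using ca cl False
      by (intro continuous_intros) auto
  next
    case True
    then have f0: "f 0 = 0" using zero x by blast
    have lim: "(l \<longlongrightarrow> 0) (at x within S)" using cl True by (simp add: continuous_within)
    have inS: "\<forall>\<^sub>F y in at x within S. y \<in> S"
      by (simp add: eventually_at_filter)
    have small: "\<forall>\<^sub>F y in at x within S. l y < 1"
      using order_tendstoD(2)[OF lim, of 1] by simp
    have bd: "0 \<le> cost_share f (a y) (l y) \<and> cost_share f (a y) (l y) \<le> l y * f 1"
      if "y \<in> S" "l y < 1" for y
    proof -
      have ay: "0 \<le> a y" "a y \<le> l y" using bounds that by auto
      have "f (l y) \<ge> 0" using mono_onD[OF mono, of 0 "l y"] ay f0 by simp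
      moreover have "f (l y) \<le> l y * f 1"
        using strictly_convex_on_leD[OF conv, of 0 1 "1 - l y" "l y"] ay that f0 by simp
      moreover have "0 \<le> a y / l y" "a y / l y \<le> 1" using ay by (auto simp: divide_le_eq_1)
      ultimately show ?thesis unfolding cost_share_def
        by (smt (verit) mult_left_le_one_le mult_nonneg_nonneg)
    qed
    have "((\<lambda>y. cost_share f (a y) (l y)) \<longlongrightarrow> 0) (at x within S)"
    proof (rule tendsto_sandwich[where f = "\<lambda>_. 0" and h = "\<lambda>y. l y * f 1"])
      show "((\<lambda>y. l y * f 1) \<longlongrightarrow> 0) (at x within S)"
        using tendsto_mult_left_zero[OF lim] by simp
      show "\<forall>\<^sub>F y in at x within S. 0 \<le> cost_share f (a y) (l y)"
        "\<forall>\<^sub>F y in at x within S. cost_share f (a y) (l y) \<le> l y * f 1"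
        using eventually_conj[OF inS small] bd by (auto elim!: eventually_mono)
    qed simp
    then show ?thesis using True by (simp add: continuous_within cost_share_def)
  qed
qed

section \<open>Points that minimize their own cost function\<close>

lemma norm_midpoint_less:
  fixes p q :: "'v::real_inner"
  assumes "p \<noteq> q"
  shows "(norm ((1/2) *\<^sub>R p + (1/2) *\<^sub>R q))\<^sup>2 < ((norm p)\<^sup>2 + (norm q)\<^sup>2) / 2"
proof -
  have "((norm p)\<^sup>2 + (norm q)\<^sup>2) / 2 - (norm ((1/2) *\<^sub>R p + (1/2) *\<^sub>R q))\<^sup>2 = (norm (p - q))\<^sup>2 / 4"
    by (simp add: power2_norm_eq_inner inner_add_left inner_add_right inner_diff_left
        inner_diff_right inner_commute field_simps)
  moreover have "(norm (p - q))\<^sup>2 > 0" using assms by simp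
  ultimately show ?thesis by linarith
qed

text \<open>
  This is existence of Nash equilibria in disguise: in the application \<open>\<Psi> x y\<close> is the sum of the bills
  that the users face when each deviates alone from \<open>x\<close> to its component of \<open>y\<close>.  Minimizers of
  \<open>\<Psi> x\<close> need not be unique, so a set-valued fixed-point theorem would be required.  Adding the
  proximal term \<open>(norm (y - x))\<^sup>2\<close> makes the minimizer \<open>F x\<close> unique, and \<open>F\<close> is then continuous
  because its graph is closed and \<open>K\<close> is compact; Brouwer's theorem gives a fixed point.  At a fixed
  point the proximal term is of second order along segments while \<open>\<Psi> x\<close> is convex, so the fixed
  point minimizes \<open>\<Psi> x\<close> itself.
\<close>

lemma ex_self_minimizer:
  fixes \<Psi> :: "'v::euclidean_space \<Rightarrow> 'v \<Rightarrow> real"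
  assumes K: "compact K" "convex K" "K \<noteq> {}"
    and cont: "continuous_on (K \<times> K) (\<lambda>(x, y). \<Psi> x y)"
    and conv: "\<And>x. x \<in> K \<Longrightarrow> convex_on K (\<Psi> x)"
  obtains x where "x \<in> K" "\<And>y. y \<in> K \<Longrightarrow> \<Psi> x x \<le> \<Psi> x y"
proof -
  define \<Phi> where "\<Phi> x y = \<Psi> x y + (norm (y - x))\<^sup>2" for x y
  have cont\<Phi>: "continuous_on (K \<times> K) (\<lambda>p. \<Phi> (fst p) (snd p))"
    using cont unfolding \<Phi>_def by (intro continuous_intros) (auto simp: case_prod_unfold)
  have minimizer: "\<exists>y\<in>K. \<forall>z\<in>K. \<Phi> x y \<le> \<Phi> x z" if x: "x \<in> K" for x
  proof (rule continuous_attains_inf[OF K(1,3)])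
    show "continuous_on K (\<Phi> x)"
      using continuous_on_compose2[OF cont\<Phi>, of K "\<lambda>y. (x, y)"] x
      by (force intro: continuous_on_Pair continuous_on_const continuous_on_id)
  qed
  have unique: "y = z" if x: "x \<in> K" and y: "y \<in> K" "\<forall>w\<in>K. \<Phi> x y \<le> \<Phi> x w"
    and z: "z \<in> K" "\<forall>w\<in>K. \<Phi> x z \<le> \<Phi> x w" for x y z
  proof (rule ccontr)
    assume "y \<noteq> z"
    define w where "w = (1/2) *\<^sub>R y + (1/2) *\<^sub>R z"
    have w: "w \<in> K" unfolding w_def using K(2) y z by (intro convexD) auto
    have "\<Psi> x w \<le> (1/2) * \<Psi> x y + (1/2) * \<Psi> x z"
      using convex_onD[OF conv[OF x], of "1/2" y z] y z by (simp add: w_def)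
    moreover have "w - x = (1/2) *\<^sub>R (y - x) + (1/2) *\<^sub>R (z - x)"
      unfolding w_def by (simp add: algebra_simps flip: scaleR_add_left)
    then have "(norm (w - x))\<^sup>2 < ((norm (y - x))\<^sup>2 + (norm (z - x))\<^sup>2) / 2"
      using norm_midpoint_less[of "y - x" "z - x"] \<open>y \<noteq> z\<close> by simp
    ultimately have "\<Phi> x w < (\<Phi> x y + \<Phi> x z) / 2" unfolding \<Phi>_def by argo
    moreover have "\<Phi> x y \<le> \<Phi> x w" "\<Phi> x z \<le> \<Phi> x w" using y z w by auto
    ultimately show False by (simp add: field_simps)
  qed
  obtain F where F: "\<And>x. x \<in> K \<Longrightarrow> F x \<in> K" "\<And>x z. x \<in> K \<Longrightarrow> z \<in> K \<Longrightarrow> \<Phi> x (F x) \<le> \<Phi> x z"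
    using bchoice[of K "\<lambda>x y. y \<in> K \<and> (\<forall>z\<in>K. \<Phi> x y \<le> \<Phi> x z)"] minimizer by blast
  have graph: "(\<lambda>x. (x, F x)) ` K
      = {p \<in> K \<times> K. \<forall>z\<in>K. \<Phi> (fst p) (snd p) - \<Phi> (fst p) z \<le> 0}" (is "_ = ?G")
  proof (intro equalityI subsetI)
    fix p assume "p \<in> ?G"
    then show "p \<in> (\<lambda>x. (x, F x)) ` K"
      using unique[of "fst p" "snd p" "F (fst p)"] F by (auto intro!: image_eqI[of _ _ "fst p"])
  qed (use F in auto)
  have KK: "closed (K \<times> K)" using K(1) by (simp add: closed_Times compact_imp_closed)
  have "closed {p \<in> K \<times> K. \<Phi> (fst p) (snd p) - \<Phi> (fst p) z \<le> 0}" if "z \<in> K" for z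
  proof -
    have "continuous_on (K \<times> K) (\<lambda>p. \<Phi> (fst p) z)"
      using continuous_on_compose2[OF cont\<Phi>, of "K \<times> K" "\<lambda>p. (fst p, z)"] that
      by (force intro!: continuous_intros)
    then have "continuous_on (K \<times> K) (\<lambda>p. \<Phi> (fst p) (snd p) - \<Phi> (fst p) z)"
      using cont\<Phi> by (intro continuous_intros)
    from continuous_closed_preimage[OF this KK, of "{..0}"] show ?thesis
      by (simp add: vimage_def Int_def)
  qed
  then have "closed (\<Inter>z\<in>K. {p \<in> K \<times> K. \<Phi> (fst p) (snd p) - \<Phi> (fst p) z \<le> 0})"
    by auto
  also have "(\<Inter>z\<in>K. {p \<in> K \<times> K. \<Phi> (fst p) (snd p) - \<Phi> (fst p) z \<le> 0}) = ?G"
    using K(3) by auto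
  finally have "closed ((\<lambda>x. (x, F x)) ` K)" using graph by simp
  then have "continuous_on K F"
    using continuous_from_closed_graph[OF K(1), of F K] F by auto
  then obtain x where x: "x \<in> K" "F x = x"
    using brouwer[OF K] F(1) by blast
  have "\<Psi> x x \<le> \<Psi> x y" if y: "y \<in> K" for y
  proof -
    \<comment> \<open>Compare \<open>x\<close> with the point at parameter \<open>t\<close> on the segment to \<open>y\<close>, divide by \<open>t\<close>, let \<open>t\<close> tend to \<open>0\<close>.\<close>
    have *: "0 \<le> \<Psi> x y - \<Psi> x x + t * (norm (y - x))\<^sup>2" if t: "0 < t" "t \<le> 1" for t
    proof -
      define z where "z = (1 - t) *\<^sub>R x + t *\<^sub>R y"
      have z: "z \<in> K" unfolding z_def using K(2) x y t by (intro convexD) auto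
      have "\<Psi> x z \<le> (1 - t) * \<Psi> x x + t * \<Psi> x y"
        using conv[OF x(1)] x y t unfolding convex_on_def z_def by simp
      moreover have "z - x = t *\<^sub>R (y - x)" unfolding z_def by (simp add: algebra_simps)
      then have "(norm (z - x))\<^sup>2 = t\<^sup>2 * (norm (y - x))\<^sup>2"
        by (simp add: power_mult_distrib)
      moreover have "\<Psi> x x \<le> \<Psi> x z + (norm (z - x))\<^sup>2"
        using F(2)[OF x(1) z] x(2) by (simp add: \<Phi>_def)
      ultimately have "0 \<le> t * (\<Psi> x y - \<Psi> x x + t * (norm (y - x))\<^sup>2)"
        by (simp add: algebra_simps power2_eq_square)
      then show ?thesis using t by (simp add: zero_le_mult_iff)
    qed
    have "((\<lambda>t. \<Psi> x y - \<Psi> x x + t * (norm (y - x))\<^sup>2) \<longlongrightarrow> \<Psi> x y - \<Psi> x x + 0 * (norm (y - x))\<^sup>2)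
        (at_right 0)"
      by (intro tendsto_intros)
    moreover have "\<forall>\<^sub>F t in at_right 0. 0 \<le> \<Psi> x y - \<Psi> x x + t * (norm (y - x))\<^sup>2"
      using eventually_at_right_real[of 0 "1::real"] *
      by (auto elim!: eventually_mono)
    ultimately have "0 \<le> \<Psi> x y - \<Psi> x x + 0 * (norm (y - x))\<^sup>2"
      by (rule tendsto_lowerbound) simp
    then show ?thesis by simp
  qed
  with x(1) that show ?thesis by blast
qed

lemma convex_on_sum_functions:
  assumes "finite I" "convex S" "\<And>i. i \<in> I \<Longrightarrow> convex_on S (f i)"
  shows "convex_on S (\<lambda>x. \<Sum>i\<in>I. f i x)"
  using assms(1,3)
  by (induction rule: finite_induct) (auto intro: convex_on_add simp: convex_on_def[of S "\<lambda>_. 0"] assms(2))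

section \<open>The game in terms of loads\<close>

text \<open>
  Bills depend on a profile only through the loads.  Passing to loads turns the strategies into compact
  convex subsets of a Euclidean space, which Brouwer's theorem requires, whatever the type of
  appliances; and the loads are also the part of an equilibrium that is unique.
\<close>

definition load_profiles :: "('n \<Rightarrow> (real^'h) set) \<Rightarrow> (real^'h^'n) set" where
  "load_profiles K = {L. \<forall>n. L $ n \<in> K n}"

definition period_load :: "real^'h^'n \<Rightarrow> 'h \<Rightarrow> real" where
  "period_load L h = (\<Sum>n\<in>UNIV. L $ n $ h)"

definition load_bill :: "('h \<Rightarrow> real \<Rightarrow> real) \<Rightarrow> 'n \<Rightarrow> real^'h^'n \<Rightarrow> real" where
  "load_bill C n L = (\<Sum>h\<in>UNIV. cost_share (C h) (L $ n $ h) (period_load L h))"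

definition replace_load :: "real^'h^'n \<Rightarrow> 'n \<Rightarrow> real^'h \<Rightarrow> real^'h^'n" where
  "replace_load L n k = (\<chi> m. if m = n then k else L $ m)"

definition load_equilibrium ::
  "('n \<Rightarrow> (real^'h) set) \<Rightarrow> ('h \<Rightarrow> real \<Rightarrow> real) \<Rightarrow> real^'h^'n \<Rightarrow> bool" where
  "load_equilibrium K C L \<longleftrightarrow> L \<in> load_profiles K \<and>
     (\<forall>n. \<forall>k\<in>K n. load_bill C n L \<le> load_bill C n (replace_load L n k))"

lemma replace_load_nth [simp]:
  "replace_load L n k $ n = k" "m \<noteq> n \<Longrightarrow> replace_load L n k $ m = L $ m"
  by (simp_all add: replace_load_def)

lemma replace_load_id [simp]: "replace_load L n (L $ n) = L"
  by (simp add: replace_load_def vec_eq_iff)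

lemma replace_load_in_profiles:
  "L \<in> load_profiles K \<Longrightarrow> k \<in> K n \<Longrightarrow> replace_load L n k \<in> load_profiles K"
  by (simp add: load_profiles_def replace_load_def)

lemma period_load_replace:
  "period_load (replace_load L n k) h = (period_load L h - L $ n $ h) + k $ h"
  unfolding period_load_def
  by (subst (1 2) sum.remove[of _ n]) auto

lemma continuous_on_period_load_replace:
  "continuous_on S (\<lambda>p. period_load (replace_load (fst p) n (snd p $ n)) h)"
  unfolding period_load_replace by (simp add: period_load_def) (intro continuous_intros)

lemma cost_share_eq_unit_price: "cost_share (C h) a l = a * unit_price C h l"
  by (simp add: cost_share_def unit_price_def)

locale load_game =
  fixes K :: "'n::finite \<Rightarrow> (real^'h::finite) set" and C :: "'h \<Rightarrow> real \<Rightarrow> real"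
  assumes compact_K: "compact (K n)" and convex_K: "convex (K n)" and K_nonempty: "K n \<noteq> {}"
    and K_nonneg: "k \<in> K n \<Longrightarrow> 0 \<le> k $ h"
    and C_mono: "mono_on {0..} (C h)" and C_convex: "strictly_convex_on {0..} (C h)"
    and C_differentiable: "0 < l \<Longrightarrow> C h differentiable (at l)"
    and C_zero: "\<lbrakk>L \<in> load_profiles K; period_load L h = 0\<rbrakk> \<Longrightarrow> C h 0 = 0"
    and price_increasing: "\<lbrakk>L \<in> load_profiles K; 0 < period_load L h\<rbrakk>
      \<Longrightarrow> 0 \<le> deriv (unit_price C h) (period_load L h)"
begin

lemma profile_nonneg: "L \<in> load_profiles K \<Longrightarrow> 0 \<le> L $ n $ h"
  using K_nonneg by (auto simp: load_profiles_def)

lemma load_le_period_load: "L \<in> load_profiles K \<Longrightarrow> L $ n $ h \<le> period_load L h"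
  unfolding period_load_def using profile_nonneg by (intro member_le_sum) auto

lemma period_load_nonneg: "L \<in> load_profiles K \<Longrightarrow> 0 \<le> period_load L h"
  unfolding period_load_def using profile_nonneg by (intro sum_nonneg) auto

lemma no_load_in_idle_period: "L \<in> load_profiles K \<Longrightarrow> period_load L h = 0 \<Longrightarrow> L $ n $ h = 0"
  using load_le_period_load profile_nonneg by (metis order_antisym)

lemma profiles_nonempty: "load_profiles K \<noteq> {}"
proof -
  have "(\<chi> n. SOME k. k \<in> K n) \<in> load_profiles K"
    using K_nonempty by (simp add: load_profiles_def some_in_eq)
  then show ?thesis by blast
qed

lemma convex_profiles: "convex (load_profiles K)"
  using convex_K unfolding load_profiles_def convex_def by auto

lemma compact_profiles: "compact (load_profiles K)"
proof -
  obtain B where B: "\<And>n k. k \<in> K n \<Longrightarrow> norm k \<le> B n"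
    using compact_imp_bounded[OF compact_K] unfolding bounded_iff by metis
  have "norm L \<le> (\<Sum>n\<in>UNIV. B n)" if "L \<in> load_profiles K" for L
  proof -
    have "norm L \<le> (\<Sum>n\<in>UNIV. norm (L $ n))"
      unfolding norm_vec_def by (intro L2_set_le_sum) auto
    also have "\<dots> \<le> (\<Sum>n\<in>UNIV. B n)"
      using that B by (intro sum_mono) (auto simp: load_profiles_def)
    finally show ?thesis .
  qed
  then have "bounded (load_profiles K)" by (auto simp: bounded_iff)
  moreover have "load_profiles K = (\<Inter>n. (\<lambda>L. L $ n) -` K n)"
    by (auto simp: load_profiles_def)
  then have "closed (load_profiles K)"
    using compact_imp_closed[OF compact_K]
    by (auto intro!: closed_INT continuous_closed_vimage continuous_intros)
  ultimately show ?thesis by (simp add: compact_eq_bounded_closed)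
qed

lemma period_load_convex_combination:
  "period_load (u *\<^sub>R L + v *\<^sub>R M) h = u * period_load L h + v * period_load M h"
  by (simp add: period_load_def sum.distrib sum_distrib_left)

lemma unit_price_differentiable: "0 < l \<Longrightarrow> unit_price C h differentiable (at l)"
  unfolding unit_price_def using C_differentiable by (intro derivative_intros) auto

text \<open>
  Feasible total loads form an interval, since profiles form a convex set; hence the sign of the
  derivative at feasible loads suffices for the mean value theorem.
\<close>

lemma unit_price_mono:
  assumes "L \<in> load_profiles K" "M \<in> load_profiles K"
    and le: "0 < period_load L h" "period_load L h \<le> period_load M h"
  shows "unit_price C h (period_load L h) \<le> unit_price C h (period_load M h)"
proof (rule DERIV_nonneg_imp_nondecreasing[OF le(2)])
  fix r assume r: "period_load L h \<le> r" "r \<le> period_load M h"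
  then have "r \<in> closed_segment (period_load L h) (period_load M h)"
    by (simp add: closed_segment_eq_real_ivl)
  then obtain t where t: "0 \<le> t" "t \<le> 1"
    "r = (1 - t) * period_load L h + t * period_load M h"
    unfolding closed_segment_def by auto
  define P where "P = (1 - t) *\<^sub>R L + t *\<^sub>R M"
  have "P \<in> load_profiles K" "period_load P h = r"
    unfolding P_def using convexD[OF convex_profiles, of L M "1 - t" t] assms t
    by (auto simp: period_load_convex_combination)
  then have "0 \<le> deriv (unit_price C h) r" using price_increasing[of P h] le r by simp
  moreover have "(unit_price C h has_real_derivative deriv (unit_price C h) r) (at r)"
    using unit_price_differentiable[of r h] le r DERIV_deriv_iff_real_differentiable by auto
  ultimately show "\<exists>y. (unit_price C h has_real_derivative y) (at r) \<and> 0 \<le> y" by blast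
qed

subsection \<open>Existence\<close>

text \<open>
  The profiles obtained by unilateral deviation from \<open>L\<close> are feasible because the set of profiles is a
  product; so the price is monotone between the total loads that are compared here.
\<close>

lemma cost_share_convex_on_profiles:
  assumes L: "L \<in> load_profiles K"
  shows "convex_on (load_profiles K) (\<lambda>M.
    cost_share (C h) (M $ n $ h) (period_load (replace_load L n (M $ n)) h))"
proof (rule convex_onI[OF _ convex_profiles])
  fix t :: real and M N
  assume t: "0 < t" "t < 1" and M: "M \<in> load_profiles K" and N: "N \<in> load_profiles K"
  define s where "s = period_load L h - L $ n $ h"
  have s: "0 \<le> s" using load_le_period_load[OF L] by (simp add: s_def)
  have load: "period_load (replace_load L n k) h = s + k $ h" for k
    by (simp add: period_load_replace s_def)
  have M': "replace_load L n (M $ n) \<in> load_profiles K"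
    using replace_load_in_profiles[OF L] M by (simp add: load_profiles_def)
  have N': "replace_load L n (N $ n) \<in> load_profiles K"
    using replace_load_in_profiles[OF L] N by (simp add: load_profiles_def)
  have mono: "0 \<le> (N $ n $ h - M $ n $ h) *
      (C h (s + N $ n $ h) / (s + N $ n $ h) - C h (s + M $ n $ h) / (s + M $ n $ h))"
    if "0 < s + M $ n $ h" "0 < s + N $ n $ h"
  proof (cases "M $ n $ h \<le> N $ n $ h")
    case True
    then show ?thesis
      using unit_price_mono[OF M' N', of h] that by (simp add: load unit_price_def)
  next
    case False
    then show ?thesis
      using unit_price_mono[OF N' M', of h] that
      by (intro mult_nonpos_nonpos) (simp_all add: load unit_price_def)
  qed
  have "C h 0 = 0" if "s + M $ n $ h = 0 \<or> s + N $ n $ h = 0"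
    using that C_zero[OF M', of h] C_zero[OF N', of h] by (auto simp: load)
  then show "cost_share (C h) (((1 - t) *\<^sub>R M + t *\<^sub>R N) $ n $ h)
      (period_load (replace_load L n (((1 - t) *\<^sub>R M + t *\<^sub>R N) $ n)) h)
    \<le> (1 - t) * cost_share (C h) (M $ n $ h) (period_load (replace_load L n (M $ n)) h)
      + t * cost_share (C h) (N $ n $ h) (period_load (replace_load L n (N $ n)) h)"
    using cost_share_convex[OF C_convex s profile_nonneg[OF M] profile_nonneg[OF N], of "1 - t" t]
      t mono by (simp add: load)
qed

text \<open>
  A profile that minimizes the sum of all unilateral bills against itself is an equilibrium: deviating
  in one component alone changes only one summand.
\<close>

lemma ex_load_equilibrium: "\<exists>L. load_equilibrium K C L"
proof -
  define \<Psi> where "\<Psi> L M = (\<Sum>n\<in>UNIV. load_bill C n (replace_load L n (M $ n)))"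
    for L M :: "real^'h^'n"
  have \<Psi>_eq: "\<Psi> L M = (\<Sum>n\<in>UNIV. \<Sum>h\<in>UNIV.
      cost_share (C h) (M $ n $ h) (period_load (replace_load L n (M $ n)) h))" for L M
    by (simp add: \<Psi>_def load_bill_def)
  have "continuous_on (load_profiles K \<times> load_profiles K) (\<lambda>(L, M). \<Psi> L M)"
    unfolding \<Psi>_eq case_prod_unfold
  proof (intro continuous_on_sum continuous_on_cost_share[OF _ _ _ C_mono C_convex])
    fix n h and p :: "(real^'h^'n) \<times> (real^'h^'n)"
    assume "p \<in> load_profiles K \<times> load_profiles K"
    then have p: "replace_load (fst p) n (snd p $ n) \<in> load_profiles K"
      by (auto simp: load_profiles_def replace_load_def)
    show "0 \<le> snd p $ n $ h \<and> snd p $ n $ h \<le> period_load (replace_load (fst p) n (snd p $ n)) h"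
      using profile_nonneg[OF p, of n h] load_le_period_load[OF p, of n h] by simp
    show "period_load (replace_load (fst p) n (snd p $ n)) h = 0 \<Longrightarrow> C h 0 = 0"
      using C_zero[OF p] .
  next
    fix h and r :: real assume "0 < r"
    then show "isCont (C h) r"
      using C_differentiable differentiable_imp_continuous_within by blast
  qed (intro continuous_intros continuous_on_period_load_replace)+
  moreover have "convex_on (load_profiles K) (\<Psi> L)" if "L \<in> load_profiles K" for L
    unfolding \<Psi>_eq
    by (intro convex_on_sum_functions finite cost_share_convex_on_profiles[OF that] convex_profiles)
  ultimately obtain L where L: "L \<in> load_profiles K" "\<And>M. M \<in> load_profiles K \<Longrightarrow> \<Psi> L L \<le> \<Psi> L M"
    using ex_self_minimizer[OF compact_profiles convex_profiles profiles_nonempty] by blast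
  have "load_bill C n L \<le> load_bill C n (replace_load L n k)" if k: "k \<in> K n" for n k
  proof -
    define M where "M = replace_load L n k"
    have "\<Psi> L L \<le> \<Psi> L M" using L(2) replace_load_in_profiles[OF L(1) k] by (simp add: M_def)
    moreover have "\<Psi> L L = load_bill C n L + (\<Sum>m\<in>UNIV - {n}. load_bill C m L)"
      unfolding \<Psi>_def by (subst sum.remove[of _ n]) auto
    moreover have "\<Psi> L M = load_bill C n M + (\<Sum>m\<in>UNIV - {n}. load_bill C m L)"
      unfolding \<Psi>_def by (subst sum.remove[of _ n]) (auto simp: M_def)
    ultimately show ?thesis by (simp add: M_def)
  qed
  then show ?thesis using L(1) unfolding load_equilibrium_def by blast
qed

end

section \<open>Strict monotonicity of marginal bills\<close>

text \<open>
  The sum is the quadratic form of the Jacobian of the marginal bills at the loads \<open>z\<close>,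
  where \<open>p\<close> and \<open>q\<close> stand for the first two derivatives of the unit price at the total load \<open>l\<close>.
  With \<open>S = (\<Sum>n\<in>UNIV. v n)\<close> it equals \<open>p S\<^sup>2 + p |v|\<^sup>2 + q S (z \<bullet> v)\<close>.  By the Cauchy--Schwarz
  inequality the last term is at most \<open>|q| |z| |S| |v|\<close>, and the steepness condition says exactly
  \<open>|q| |z| < 2 p\<close>, so the form is positive by the inequality between arithmetic and geometric means.
\<close>

lemma marginal_form_pos:
  fixes z v :: "'n::finite \<Rightarrow> real"
  assumes p: "0 < p" and l: "0 < l" "l = (\<Sum>n\<in>UNIV. z n)"
    and steep: "l\<^sup>2 / (\<Sum>n\<in>UNIV. (z n)\<^sup>2) > (l * q / (2 * p))\<^sup>2"
    and v: "v k \<noteq> 0"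
  shows "0 < (\<Sum>n\<in>UNIV. v n * (p * (\<Sum>m\<in>UNIV. v m) + (v n * p + z n * (q * (\<Sum>m\<in>UNIV. v m)))))"
proof -
  define S where "S = (\<Sum>n\<in>UNIV. v n)"
  define V where "V = (\<Sum>n\<in>UNIV. (v n)\<^sup>2)"
  define Z where "Z = (\<Sum>n\<in>UNIV. (z n)\<^sup>2)"
  define W where "W = (\<Sum>n\<in>UNIV. v n * z n)"
  have V: "0 < V" unfolding V_def using v by (intro sum_pos2[of _ k]) auto
  have "0 \<le> Z" unfolding Z_def by (intro sum_nonneg) auto
  have Z: "0 < Z"
  proof (rule ccontr)
    assume "\<not> 0 < Z"
    then have "(l * q / (2 * p))\<^sup>2 < 0" using \<open>0 \<le> Z\<close> steep by (simp add: Z_def)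
    then show False by (meson not_less zero_le_power2)
  qed
  have CS: "W\<^sup>2 \<le> V * Z"
    unfolding W_def V_def Z_def by (rule Cauchy_Schwarz_ineq_sum)
  have "l\<^sup>2 * (q\<^sup>2 * Z) < l\<^sup>2 * (4 * p\<^sup>2)"
    using steep Z p unfolding Z_def[symmetric]
    by (simp add: field_simps power2_eq_square)
  then have qZ: "q\<^sup>2 * Z < 4 * p\<^sup>2" using l(1) by simp
  have eq: "(\<Sum>n\<in>UNIV. v n * (p * S + (v n * p + z n * (q * S)))) = p * S\<^sup>2 + p * V + q * S * W"
  proof -
    have "v n * (p * S + (v n * p + z n * (q * S)))
        = (p * S) * v n + p * (v n)\<^sup>2 + (q * S) * (v n * z n)" for n
      by algebra
    then show ?thesis
      by (simp only: sum.distrib flip: sum_distrib_left)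
        (simp only: S_def[symmetric] V_def[symmetric] W_def[symmetric], simp add: power2_eq_square)
  qed
  have "0 < p * S\<^sup>2 + p * V + q * S * W"
  proof (cases "S = 0")
    case True
    then show ?thesis using p V by simp
  next
    case False
    have "(q * S * W)\<^sup>2 = q\<^sup>2 * S\<^sup>2 * W\<^sup>2" by (simp add: power_mult_distrib)
    also have "\<dots> \<le> q\<^sup>2 * S\<^sup>2 * (V * Z)" using CS by (intro mult_left_mono) auto
    also have "\<dots> = (q\<^sup>2 * Z) * (S\<^sup>2 * V)" by simp
    also have "\<dots> < (4 * p\<^sup>2) * (S\<^sup>2 * V)"
      using qZ False V by (intro mult_strict_right_mono) auto
    \<comment> \<open>arithmetic and geometric means of \<open>p S\<^sup>2\<close> and \<open>p V\<close>\<close>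
    also have "\<dots> \<le> (p * S\<^sup>2 + p * V)\<^sup>2"
      using zero_le_power2[of "p * S\<^sup>2 - p * V"] by (simp add: power2_eq_square algebra_simps)
    finally have "\<bar>q * S * W\<bar>\<^sup>2 < (p * S\<^sup>2 + p * V)\<^sup>2" by simp
    then have "\<bar>q * S * W\<bar> < p * S\<^sup>2 + p * V"
      by (rule power2_less_imp_less) (use p V in simp)
    then show ?thesis by linarith
  qed
  then show ?thesis using eq by (simp add: S_def)
qed

text \<open>
  Rosen's diagonal strict convexity for one period.  The marginal bill of user \<open>n\<close> is
  \<open>c l + z n c' l\<close>; the derivative along the segment from \<open>x\<close> to \<open>y\<close> of its pairing with \<open>y - x\<close> is
  the quadratic form above.
\<close>

lemma marginal_bill_strict_mono:
  fixes x y :: "'n::finite \<Rightarrow> real" and c :: "real \<Rightarrow> real"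
  defines "z \<equiv> \<lambda>t n. x n + t * (y n - x n)"
  defines "l \<equiv> \<lambda>t. \<Sum>n\<in>UNIV. z t n"
  assumes ne: "x k \<noteq> y k"
    and diff: "\<And>r. 0 < r \<Longrightarrow> c differentiable (at r)"
      "\<And>r. 0 < r \<Longrightarrow> deriv c differentiable (at r)"
    and pos: "\<And>t. \<lbrakk>0 \<le> t; t \<le> 1\<rbrakk> \<Longrightarrow> 0 < l t"
    and c'_pos: "\<And>t. \<lbrakk>0 \<le> t; t \<le> 1\<rbrakk> \<Longrightarrow> 0 < deriv c (l t)"
    and steep: "\<And>t. \<lbrakk>0 \<le> t; t \<le> 1\<rbrakk> \<Longrightarrow>
      (l t)\<^sup>2 / (\<Sum>n\<in>UNIV. (z t n)\<^sup>2) > (l t * deriv (deriv c) (l t) / (2 * deriv c (l t)))\<^sup>2"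
  shows "(\<Sum>n\<in>UNIV. (y n - x n) * (c (\<Sum>n\<in>UNIV. x n) + x n * deriv c (\<Sum>n\<in>UNIV. x n)))
    < (\<Sum>n\<in>UNIV. (y n - x n) * (c (\<Sum>n\<in>UNIV. y n) + y n * deriv c (\<Sum>n\<in>UNIV. y n)))"
proof -
  define \<phi> where "\<phi> t = (\<Sum>n\<in>UNIV. (y n - x n) * (c (l t) + z t n * deriv c (l t)))" for t
  define S where "S = (\<Sum>n\<in>UNIV. y n - x n)"
  have "\<phi> 0 < \<phi> 1"
  proof (rule DERIV_pos_imp_increasing[of 0 1 \<phi>])
    fix t :: real assume t: "0 \<le> t" "t \<le> 1"
    have dl: "(l has_real_derivative S) (at t)"
      unfolding l_def z_def S_def by (auto intro!: derivative_eq_intros)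
    have dz: "((\<lambda>t. z t n) has_real_derivative (y n - x n)) (at t)" for n
      unfolding z_def by (auto intro!: derivative_eq_intros)
    have dc: "((\<lambda>t. c (l t)) has_real_derivative deriv c (l t) * S) (at t)"
      using diff(1)[OF pos[OF t]] dl
      by (intro DERIV_chain2) (auto simp: DERIV_deriv_iff_real_differentiable)
    have ddc: "((\<lambda>t. deriv c (l t)) has_real_derivative deriv (deriv c) (l t) * S) (at t)"
      using diff(2)[OF pos[OF t]] dl
      by (intro DERIV_chain2) (auto simp: DERIV_deriv_iff_real_differentiable)
    have "(\<phi> has_real_derivative (\<Sum>n\<in>UNIV. (y n - x n) *
        (deriv c (l t) * S + ((y n - x n) * deriv c (l t) + z t n * (deriv (deriv c) (l t) * S)))))
        (at t)"
      unfolding \<phi>_def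
      by (intro DERIV_sum DERIV_cmult DERIV_add dc)
        (use DERIV_mult[OF dz ddc] in \<open>simp add: algebra_simps\<close>)
    moreover have "0 < (\<Sum>n\<in>UNIV. (y n - x n) *
        (deriv c (l t) * S + ((y n - x n) * deriv c (l t) + z t n * (deriv (deriv c) (l t) * S))))"
      unfolding S_def using ne
      by (intro marginal_form_pos[OF c'_pos[OF t] pos[OF t] _ steep[OF t], of _ k])
        (auto simp: l_def)
    ultimately show "\<exists>d. (\<phi> has_real_derivative d) (at t) \<and> 0 < d" by blast
  qed simp
  then show ?thesis by (simp add: \<phi>_def l_def z_def)
qed

section \<open>First-order conditions\<close>

context load_game
begin

text \<open>
  The derivative of the bill of user \<open>n\<close> in period \<open>h\<close> when its load moves alone from \<open>L\<close> towards \<open>M\<close>.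
  In a period with zero total load the true one-sided derivative would involve the limit price at \<open>0\<close>;
  the price at the total load of \<open>M\<close> serves as an upper bound for it that avoids the limit.
\<close>

definition marginal :: "real^'h^'n \<Rightarrow> real^'h^'n \<Rightarrow> 'n \<Rightarrow> 'h \<Rightarrow> real" where
  "marginal L M n h =
    (if period_load L h = 0 then M $ n $ h * unit_price C h (period_load M h)
     else (M $ n $ h - L $ n $ h) *
       (unit_price C h (period_load L h) + L $ n $ h * deriv (unit_price C h) (period_load L h)))"

text \<open>
  Difference quotients of the bill are bounded by a function that tends to the marginal: the quotient
  itself where the total load is positive, and a constant in an idle period, where the deviating user
  alone bears the whole cost and convexity with \<open>C h 0 = 0\<close> bounds it by a chord from the origin.
\<close>

lemma bill_difference_bound:
  fixes n :: 'n and h :: 'h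
  assumes L: "L \<in> load_profiles K" and M: "M \<in> load_profiles K"
  defines "d \<equiv> M $ n $ h - L $ n $ h"
  obtains Q where "(Q \<longlongrightarrow> marginal L M n h) (at_right 0)"
    "\<And>t. \<lbrakk>0 < t; t < 1\<rbrakk> \<Longrightarrow>
      cost_share (C h) (L $ n $ h + t * d) (period_load L h + t * d)
        - cost_share (C h) (L $ n $ h) (period_load L h) \<le> t * Q t"
proof (cases "period_load L h = 0")
  case True
  define m where "m = period_load M h"
  have L0: "L $ n $ h = 0" using no_load_in_idle_period[OF L True] .
  have C0: "C h 0 = 0" using C_zero[OF L True] .
  have M0: "0 \<le> M $ n $ h" "M $ n $ h \<le> m"
    using profile_nonneg[OF M] load_le_period_load[OF M] by (auto simp: m_def)
  have "cost_share (C h) (t * M $ n $ h) (t * M $ n $ h) \<le> t * (M $ n $ h * unit_price C h m)"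
    if t: "0 < t" "t < 1" for t
  proof (cases "m = 0")
    case True
    then show ?thesis using M0 by (simp add: cost_share_def)
  next
    case False
    define \<theta> where "\<theta> = t * M $ n $ h / m"
    have "t * M $ n $ h \<le> 1 * m" using t M0 by (intro mult_mono) auto
    then have \<theta>: "0 \<le> \<theta>" "\<theta> \<le> 1" "\<theta> * m = t * M $ n $ h"
      using False M0 t by (auto simp: \<theta>_def divide_le_eq_1)
    have "C h (t * M $ n $ h) \<le> \<theta> * C h m"
      using strictly_convex_on_leD[OF C_convex[of h], of 0 m "1 - \<theta>" \<theta>] \<theta> M0 C0 by simp
    then show ?thesis
      using C0 by (simp add: cost_share_self \<theta>_def unit_price_def)
  qed
  then show ?thesis
    using that[of "\<lambda>_. marginal L M n h"] True L0
    by (simp add: marginal_def d_def m_def cost_share_def)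
next
  case False
  then have pos: "0 < period_load L h" using period_load_nonneg[OF L, of h] by simp
  define F where "F t = cost_share (C h) (L $ n $ h + t * d) (period_load L h + t * d)" for t
  have "(unit_price C h has_real_derivative deriv (unit_price C h) (period_load L h))
      (at (period_load L h + 0 * d))"
    using unit_price_differentiable[OF pos] by (simp add: DERIV_deriv_iff_real_differentiable)
  then have "((\<lambda>t. unit_price C h (period_load L h + t * d)) has_real_derivative
      deriv (unit_price C h) (period_load L h) * d) (at 0)"
    by (rule DERIV_chain2) (auto intro!: derivative_eq_intros)
  then have "(F has_real_derivative marginal L M n h) (at 0)"
    unfolding F_def cost_share_eq_unit_price
    by (auto intro!: derivative_eq_intros simp: marginal_def False d_def algebra_simps)
  then have "((\<lambda>t. (F t - F 0) / t) \<longlongrightarrow> marginal L M n h) (at 0)"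
    by (simp add: DERIV_def)
  then have "((\<lambda>t. (F t - F 0) / t) \<longlongrightarrow> marginal L M n h) (at_right 0)"
    by (rule filterlim_mono) (simp_all add: at_le)
  then show ?thesis using that[of "\<lambda>t. (F t - F 0) / t"] by (simp add: F_def)
qed

text \<open>
  A user who moves a fraction \<open>t\<close> of the way towards \<open>M\<close> does not gain.  The change of the bill is at
  most \<open>t\<close> times a function of \<open>t\<close> that tends to the sum of the marginals.
\<close>

lemma equilibrium_imp_marginal_nonneg:
  assumes L: "load_equilibrium K C L" and M: "M \<in> load_profiles K"
  shows "0 \<le> (\<Sum>h\<in>UNIV. marginal L M n h)"
proof -
  have L': "L \<in> load_profiles K" using L by (simp add: load_equilibrium_def)
  define F where "F h t = cost_share (C h) (L $ n $ h + t * (M $ n $ h - L $ n $ h))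
      (period_load L h + t * (M $ n $ h - L $ n $ h))" for h t
  have "\<exists>Q. (Q \<longlongrightarrow> marginal L M n h) (at_right 0) \<and>
      (\<forall>t. 0 < t \<and> t < 1 \<longrightarrow> F h t - F h 0 \<le> t * Q t)" for h
    using bill_difference_bound[OF L' M, where n = n and h = h] unfolding F_def
    by (metis (no_types, lifting) add.right_neutral mult_zero_left)
  then obtain Q where Q: "\<And>h. (Q h \<longlongrightarrow> marginal L M n h) (at_right 0)"
    "\<And>h t. 0 < t \<Longrightarrow> t < 1 \<Longrightarrow> F h t - F h 0 \<le> t * Q h t"
    by metis
  have "0 \<le> (\<Sum>h\<in>UNIV. Q h t)" if t: "0 < t" "t < 1" for t
  proof -
    define k where "k = (1 - t) *\<^sub>R L $ n + t *\<^sub>R M $ n"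
    have "k \<in> K n"
      unfolding k_def using L' M t convex_K[of n]
      by (intro convexD) (auto simp: load_profiles_def)
    then have "load_bill C n L \<le> load_bill C n (replace_load L n k)"
      using L by (simp add: load_equilibrium_def)
    moreover have "load_bill C n L = (\<Sum>h\<in>UNIV. F h 0)"
      by (simp add: load_bill_def F_def)
    moreover have "load_bill C n (replace_load L n k) = (\<Sum>h\<in>UNIV. F h t)"
      unfolding load_bill_def F_def period_load_replace
      by (intro sum.cong arg_cong2[of _ _ _ _ "cost_share _"]) (simp_all add: k_def algebra_simps)
    ultimately have "0 \<le> (\<Sum>h\<in>UNIV. F h t - F h 0)" by (simp add: sum_subtractf)
    also have "\<dots> \<le> (\<Sum>h\<in>UNIV. t * Q h t)" using Q(2) t by (intro sum_mono) auto
    also have "\<dots> = t * (\<Sum>h\<in>UNIV. Q h t)" by (simp add: sum_distrib_left)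
    finally show ?thesis using t by (simp add: zero_le_mult_iff)
  qed
  then have "\<forall>\<^sub>F t in at_right 0. 0 \<le> (\<Sum>h\<in>UNIV. Q h t)"
    using eventually_at_right_real[of 0 "1::real"] by (auto elim!: eventually_mono)
  moreover have "((\<lambda>t. \<Sum>h\<in>UNIV. Q h t) \<longlongrightarrow> (\<Sum>h\<in>UNIV. marginal L M n h)) (at_right 0)"
    using Q(1) by (intro tendsto_sum)
  ultimately show ?thesis by (intro tendsto_lowerbound) auto
qed

subsection \<open>Uniqueness\<close>

context
  assumes price_twice_diff: "\<And>h l. 0 < l \<Longrightarrow> deriv (unit_price C h) differentiable (at l)"
    and price_strict: "\<And>L h. \<lbrakk>L \<in> load_profiles K; 0 < period_load L h\<rbrakk>
      \<Longrightarrow> deriv (unit_price C h) (period_load L h) \<noteq> 0"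
    and steep: "\<And>L h. \<lbrakk>L \<in> load_profiles K; 0 < period_load L h\<rbrakk> \<Longrightarrow>
      (period_load L h)\<^sup>2 / (\<Sum>n\<in>UNIV. (L $ n $ h)\<^sup>2) >
        (period_load L h * deriv (deriv (unit_price C h)) (period_load L h)
          / (2 * deriv (unit_price C h) (period_load L h)))\<^sup>2"
begin

lemma price_deriv_pos:
  "\<lbrakk>L \<in> load_profiles K; 0 < period_load L h\<rbrakk> \<Longrightarrow> 0 < deriv (unit_price C h) (period_load L h)"
  using price_increasing price_strict by (metis order_le_neq_trans)

text \<open>
  In a period that is idle in \<open>L\<close> the prices cancel, because \<open>marginal\<close> charges the price at \<open>M\<close> in
  both directions; what remains is the effect of the loads in \<open>M\<close> on the price.
\<close>

lemma marginal_sum_neg_idle: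
  assumes L: "L \<in> load_profiles K" and M: "M \<in> load_profiles K"
    and idle: "period_load L h = 0" and ne: "L $ k $ h \<noteq> M $ k $ h"
  shows "(\<Sum>n\<in>UNIV. marginal L M n h + marginal M L n h) < 0"
proof -
  have L0: "L $ n $ h = 0" for n using no_load_in_idle_period[OF L idle] .
  then have "0 < M $ k $ h" using ne profile_nonneg[OF M, of k h] by simp
  then have pos: "0 < period_load M h" using load_le_period_load[OF M, of k h] by linarith
  have "marginal L M n h + marginal M L n h
      = - deriv (unit_price C h) (period_load M h) * (M $ n $ h)\<^sup>2" for n
    using pos idle by (simp add: marginal_def L0 algebra_simps power2_eq_square)
  then have "(\<Sum>n\<in>UNIV. marginal L M n h + marginal M L n h)
      = - deriv (unit_price C h) (period_load M h) * (\<Sum>n\<in>UNIV. (M $ n $ h)\<^sup>2)"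
    by (simp add: sum_distrib_left sum_negf)
  moreover have "0 < (\<Sum>n\<in>UNIV. (M $ n $ h)\<^sup>2)"
    using \<open>0 < M $ k $ h\<close> by (intro sum_pos2[of _ k]) auto
  ultimately show ?thesis using price_deriv_pos[OF M pos] by simp
qed

lemma marginal_sum_neg:
  assumes L: "L \<in> load_profiles K" and M: "M \<in> load_profiles K"
    and ne: "L $ k $ h \<noteq> M $ k $ h"
  shows "(\<Sum>n\<in>UNIV. marginal L M n h + marginal M L n h) < 0"
proof -
  consider "period_load L h = 0" | "period_load M h = 0"
    | "0 < period_load L h" "0 < period_load M h"
    using period_load_nonneg[OF L, of h] period_load_nonneg[OF M, of h] by fastforce
  then show ?thesis
  proof cases
    case 1
    then show ?thesis using marginal_sum_neg_idle[OF L M _ ne] by simp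
  next
    case 2
    then show ?thesis
      using marginal_sum_neg_idle[OF M L, of h k] ne by (simp add: add.commute)
  next
    case 3
    define P where "P t = (1 - t) *\<^sub>R L + t *\<^sub>R M" for t
    have P: "P t \<in> load_profiles K" "0 < period_load (P t) h" if "0 \<le> t" "t \<le> 1" for t
    proof -
      show "P t \<in> load_profiles K"
        unfolding P_def using L M that by (intro convexD[OF convex_profiles]) auto
      show "0 < period_load (P t) h"
        using 3 that unfolding P_def period_load_convex_combination
        by (cases "t = 0") (auto intro!: add_nonneg_pos mult_nonneg_nonneg)
    qed
    have z: "L $ n $ h + t * (M $ n $ h - L $ n $ h) = P t $ n $ h" for t n
      by (simp add: P_def algebra_simps)
    have l: "(\<Sum>n\<in>UNIV. P t $ n $ h) = period_load (P t) h" for t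
      by (simp add: period_load_def)
    have "(\<Sum>n\<in>UNIV. (M $ n $ h - L $ n $ h) * (unit_price C h (period_load L h)
          + L $ n $ h * deriv (unit_price C h) (period_load L h)))
      < (\<Sum>n\<in>UNIV. (M $ n $ h - L $ n $ h) * (unit_price C h (period_load M h)
          + M $ n $ h * deriv (unit_price C h) (period_load M h)))"
      unfolding period_load_def
      using marginal_bill_strict_mono[where x = "\<lambda>n. L $ n $ h" and y = "\<lambda>n. M $ n $ h"
          and c = "unit_price C h", unfolded z l, OF ne unit_price_differentiable price_twice_diff
          P(2) price_deriv_pos[OF P] steep[OF P]]
      by simp
    moreover have "marginal L M n h = (M $ n $ h - L $ n $ h) * (unit_price C h (period_load L h)
          + L $ n $ h * deriv (unit_price C h) (period_load L h))"
      "marginal M L n h = - ((M $ n $ h - L $ n $ h) * (unit_price C h (period_load M h)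
          + M $ n $ h * deriv (unit_price C h) (period_load M h)))" for n
      using 3 by (simp_all add: marginal_def algebra_simps)
    ultimately show ?thesis by (simp add: sum_subtractf)
  qed
qed

text \<open>
  Adding the first-order conditions of two equilibria towards each other over all users gives a
  nonnegative number; but every period contributes a nonpositive amount, and a negative one if the
  loads differ in it.
\<close>

lemma load_equilibrium_unique:
  assumes L: "load_equilibrium K C L" and M: "load_equilibrium K C M"
  shows "L = M"
proof (rule ccontr)
  assume "L \<noteq> M"
  then obtain k h where ne: "L $ k $ h \<noteq> M $ k $ h" by (auto simp: vec_eq_iff)
  have LM: "L \<in> load_profiles K" "M \<in> load_profiles K"
    using L M by (auto simp: load_equilibrium_def)
  have "(\<Sum>n\<in>UNIV. marginal L M n g + marginal M L n g) \<le> 0" for g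
  proof (cases "\<exists>n. L $ n $ g \<noteq> M $ n $ g")
    case True
    then show ?thesis using marginal_sum_neg[OF LM] by fastforce
  next
    case False
    then have "period_load L g = period_load M g" by (simp add: period_load_def)
    with False have "marginal L M n g = 0" "marginal M L n g = 0" for n
      using no_load_in_idle_period[OF LM(1)] by (auto simp: marginal_def)
    then show ?thesis by simp
  qed
  then have "(\<Sum>g\<in>UNIV. \<Sum>n\<in>UNIV. marginal L M n g + marginal M L n g) < 0"
    using marginal_sum_neg[OF LM ne] by (intro sum_strict_mono_ex1[THEN order_less_le_trans, of _ _ "\<lambda>_. 0"]) auto
  also have "(\<Sum>g\<in>UNIV. \<Sum>n\<in>UNIV. marginal L M n g + marginal M L n g)
      = (\<Sum>n\<in>UNIV. (\<Sum>g\<in>UNIV. marginal L M n g) + (\<Sum>g\<in>UNIV. marginal M L n g))"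
    by (subst sum.swap) (simp add: sum.distrib)
  also have "0 \<le> \<dots>"
    using equilibrium_imp_marginal_nonneg[OF L LM(2)] equilibrium_imp_marginal_nonneg[OF M LM(1)]
    by (simp add: sum_nonneg)
  finally show False by simp
qed

end

end

section \<open>From appliances to loads\<close>

definition strategy_load :: "('n \<Rightarrow> 'a set) \<Rightarrow> 'n \<Rightarrow> ('a \<Rightarrow> 'h \<Rightarrow> real) \<Rightarrow> real^'h" where
  "strategy_load A n y = (\<chi> h. \<Sum>a\<in>A n. y a h)"

definition profile_load :: "('n \<Rightarrow> 'a set) \<Rightarrow> ('n \<Rightarrow> 'a \<Rightarrow> 'h \<Rightarrow> real) \<Rightarrow> real^'h^'n" where
  "profile_load A x = (\<chi> n. strategy_load A n (x n))"

lemma profile_load_nth [simp]: "profile_load A x $ n $ h = user_load A x n h"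
  by (simp add: profile_load_def strategy_load_def user_load_def)

lemma period_load_profile_load [simp]: "period_load (profile_load A x) h = total_load A x h"
  by (simp add: period_load_def total_load_def)

lemma bill_HP_eq_load_bill: "bill_HP A C n x = load_bill C n (profile_load A x)"
  by (simp add: bill_HP_def load_bill_def cost_share_def total_load_def)

lemma profile_load_upd:
  "profile_load A (x(n := y)) = replace_load (profile_load A x) n (strategy_load A n y)"
  by (simp add: profile_load_def replace_load_def vec_eq_iff)

lemma profile_load_eq_iff: "profile_load A x = profile_load A y \<longleftrightarrow> user_load A x = user_load A y"
  by (simp add: vec_eq_iff fun_eq_iff)

lemma compact_sums_finite:
  fixes S :: "'i \<Rightarrow> 'v::real_normed_vector set"
  assumes "finite I" "\<And>i. i \<in> I \<Longrightarrow> compact (S i)"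
  shows "compact {\<Sum>i\<in>I. g i | g. \<forall>i\<in>I. g i \<in> S i}"
  using assms
proof (induction rule: finite_induct)
  case empty
  then show ?case by simp
next
  case (insert j I)
  have "{\<Sum>i\<in>insert j I. g i | g. \<forall>i\<in>insert j I. g i \<in> S i}
      = {x + y | x y. x \<in> S j \<and> y \<in> {\<Sum>i\<in>I. g i | g. \<forall>i\<in>I. g i \<in> S i}}" (is "?l = ?r")
  proof (intro equalityI subsetI)
    fix w assume "w \<in> ?l"
    then show "w \<in> ?r" using insert.hyps by auto
  next
    fix w assume "w \<in> ?r"
    then obtain x g where g: "w = x + (\<Sum>i\<in>I. g i)" "x \<in> S j" "\<forall>i\<in>I. g i \<in> S i" by blast
    moreover have "(\<Sum>i\<in>I. g i) = (\<Sum>i\<in>I. (g(j := x)) i)"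
      using insert.hyps by (intro sum.cong) auto
    ultimately show "w \<in> ?l"
      using insert.hyps by (intro CollectI exI[of _ "g(j := x)"]) auto
  qed
  moreover have "compact {x + y | x y. x \<in> S j \<and> y \<in> {\<Sum>i\<in>I. g i | g. \<forall>i\<in>I. g i \<in> S i}}"
    using insert.IH insert.prems by (intro compact_sums) auto
  ultimately show ?case by simp
qed

text \<open>
  The possible loads of a user are the sums of one vector from each of finitely many compact
  polytopes, one per appliance.
\<close>

lemma compact_strategy_loads:
  fixes lo :: "'n \<Rightarrow> 'a \<Rightarrow> 'h::finite \<Rightarrow> real"
  assumes "finite (A n)"
  shows "compact (strategy_load A n ` strategy_set A E lo hi n)"
proof -
  define S where "S a = {v :: real^'h. (\<Sum>h\<in>UNIV. v $ h) = E n a} \<inter>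
    cbox (\<chi> h. lo n a h) (\<chi> h. hi n a h)" for a
  have "compact (S a)" for a
    unfolding S_def
    by (intro closed_Int_compact compact_cbox closed_Collect_eq continuous_intros)
  moreover have "strategy_load A n ` strategy_set A E lo hi n
      = {\<Sum>a\<in>A n. g a | g. \<forall>a\<in>A n. g a \<in> S a}" (is "?l = ?r")
  proof (intro equalityI subsetI)
    fix v assume "v \<in> ?l"
    then obtain y where "y \<in> strategy_set A E lo hi n" "v = strategy_load A n y" by blast
    then show "v \<in> ?r"
      by (intro CollectI exI[of _ "\<lambda>a. \<chi> h. y a h"])
        (auto simp: S_def strategy_set_def strategy_load_def mem_box_cart vec_eq_iff)
  next
    fix v assume "v \<in> ?r"
    then obtain g where "v = (\<Sum>a\<in>A n. g a)" "\<forall>a\<in>A n. g a \<in> S a" by blast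
    then show "v \<in> ?l"
      by (intro image_eqI[of _ _ "\<lambda>a h. if a \<in> A n then g a $ h else 0"])
        (auto simp: S_def strategy_set_def strategy_load_def mem_box_cart vec_eq_iff)
  qed
  ultimately show ?thesis using compact_sums_finite[OF assms, of S] by simp
qed

lemma convex_strategy_loads: "convex (strategy_load A n ` strategy_set A E lo hi n)"
proof (rule convexI)
  fix v w and s t :: real
  assume "v \<in> strategy_load A n ` strategy_set A E lo hi n"
    "w \<in> strategy_load A n ` strategy_set A E lo hi n" and st: "0 \<le> s" "0 \<le> t" "s + t = 1"
  then obtain y z where y: "y \<in> strategy_set A E lo hi n" "v = strategy_load A n y"
    and z: "z \<in> strategy_set A E lo hi n" "w = strategy_load A n z" by blast
  have E: "s * e + t * e = e" for e using st by (simp flip: distrib_right)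
  have "l \<le> s * p + t * q" if "l \<le> p" "l \<le> q" for l p q
    using add_mono[OF mult_left_mono[OF that(1) st(1)] mult_left_mono[OF that(2) st(2)]] E[of l]
    by simp
  moreover have "s * p + t * q \<le> r" if "p \<le> r" "q \<le> r" for r p q
    using add_mono[OF mult_left_mono[OF that(1) st(1)] mult_left_mono[OF that(2) st(2)]] E[of r]
    by simp
  ultimately have "(\<lambda>a h. s * y a h + t * z a h) \<in> strategy_set A E lo hi n"
    using y(1) z(1) by (simp add: strategy_set_def sum.distrib E flip: sum_distrib_left)
  moreover have "s *\<^sub>R v + t *\<^sub>R w = strategy_load A n (\<lambda>a h. s * y a h + t * z a h)"
    by (simp add: y z strategy_load_def vec_eq_iff sum.distrib sum_distrib_left)
  ultimately show "s *\<^sub>R v + t *\<^sub>R w \<in> strategy_load A n ` strategy_set A E lo hi n" by blast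
qed

lemma load_profiles_strategy_loads:
  "load_profiles (\<lambda>n. strategy_load A n ` strategy_set A E lo hi n)
    = profile_load A ` profile_set A E lo hi" (is "?l = ?r")
proof (intro equalityI subsetI)
  fix L assume "L \<in> ?l"
  then have "\<forall>n. \<exists>y. y \<in> strategy_set A E lo hi n \<and> L $ n = strategy_load A n y"
    by (auto simp: load_profiles_def)
  then obtain x where x: "\<And>n. x n \<in> strategy_set A E lo hi n \<and> L $ n = strategy_load A n (x n)"
    by metis
  then have "L = profile_load A x" by (simp add: profile_load_def vec_eq_iff)
  with x show "L \<in> ?r" by (auto simp: profile_set_def)
qed (auto simp: load_profiles_def profile_set_def profile_load_def)

lemma nash_equilibrium_iff_load_equilibrium:
  "nash_equilibrium A E lo hi C x \<longleftrightarrow> x \<in> profile_set A E lo hi \<and>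
    load_equilibrium (\<lambda>n. strategy_load A n ` strategy_set A E lo hi n) C (profile_load A x)"
proof (cases "x \<in> profile_set A E lo hi")
  case True
  then have "profile_load A x \<in> profile_load A ` profile_set A E lo hi" by (rule imageI)
  with True show ?thesis
    by (simp add: nash_equilibrium_def load_equilibrium_def bill_HP_eq_load_bill
        profile_load_upd load_profiles_strategy_loads)
qed (simp add: nash_equilibrium_def)

lemma profile_determined_by_loads:
  assumes fin: "\<And>n. finite (A n)" and single: "\<And>n. card (A n) \<le> 1"
    and x: "x \<in> profile_set A E lo hi" and y: "y \<in> profile_set A E lo hi"
    and loads: "user_load A x = user_load A y"
  shows "x = y"
proof (intro ext)
  fix n a h
  show "x n a h = y n a h"
  proof (cases "a \<in> A n")
    case True
    then have "A n = {a}"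
      using single[of n] fin[of n] by (auto simp: card_le_Suc0_iff_eq)
    then show ?thesis using fun_cong[OF fun_cong[OF loads], of n h] by (simp add: user_load_def)
  next
    case False
    then show ?thesis using x y by (simp add: profile_set_def strategy_set_def)
  qed
qed

text \<open>
  The uniqueness proof determines the loads.  They determine the profile when no user has more than
  one appliance; a user with several may be able to exchange power between
  them at equal load.
\<close>

theorem theorem1:
  fixes A :: "'n::finite \<Rightarrow> 'a set"
    and E :: "'n \<Rightarrow> 'a \<Rightarrow> real"
    and lo hi :: "'n \<Rightarrow> 'a \<Rightarrow> 'h::finite \<Rightarrow> real"
    and C :: "'h \<Rightarrow> real \<Rightarrow> real"
  assumes finite_appliances: "\<And>n. finite (A n)"
    and power_nonneg: "\<And>n a h. a \<in> A n \<Longrightarrow> 0 \<le> lo n a h"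
    and strategies_nonempty: "\<And>n. strategy_set A E lo hi n \<noteq> {}"
    and cost_increasing: "\<And>h. mono_on {0..} (C h)"
    and cost_strictly_convex: "\<And>h. strictly_convex_on {0..} (C h)"
    and cost_differentiable: "\<And>h l. 0 < l \<Longrightarrow> C h differentiable (at l)"
    and zero_load: "\<And>x h. \<lbrakk>x \<in> profile_set A E lo hi; total_load A x h = 0\<rbrakk> \<Longrightarrow> C h 0 = 0"
    and price_increasing: "\<And>x h. \<lbrakk>x \<in> profile_set A E lo hi; 0 < total_load A x h\<rbrakk> \<Longrightarrow>
           0 \<le> deriv (unit_price C h) (total_load A x h)"
  shows "(\<exists>x. nash_equilibrium A E lo hi C x) \<and>
    ((\<forall>h. \<forall>l>0. deriv (unit_price C h) differentiable (at l)) \<and>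
     (\<forall>x\<in>profile_set A E lo hi. \<forall>h. 0 < total_load A x h \<longrightarrow>
        deriv (unit_price C h) (total_load A x h) \<noteq> 0 \<and>
        (total_load A x h)\<^sup>2 / (\<Sum>n\<in>UNIV. (user_load A x n h)\<^sup>2) >
          (total_load A x h * deriv (deriv (unit_price C h)) (total_load A x h)
             / (2 * deriv (unit_price C h) (total_load A x h)))\<^sup>2)
     \<longrightarrow>
     (\<exists>!L. \<exists>x. nash_equilibrium A E lo hi C x \<and> user_load A x = L) \<and>
     ((\<forall>n. card (A n) \<le> 1) \<longrightarrow> (\<exists>!x. nash_equilibrium A E lo hi C x)))"
proof -
  define K where "K n = strategy_load A n ` strategy_set A E lo hi n" for n
  have profiles: "load_profiles K = profile_load A ` profile_set A E lo hi"
    unfolding K_def by (rule load_profiles_strategy_loads)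
  have nash_iff: "nash_equilibrium A E lo hi C x \<longleftrightarrow>
      x \<in> profile_set A E lo hi \<and> load_equilibrium K C (profile_load A x)" for x
    unfolding K_def by (rule nash_equilibrium_iff_load_equilibrium)
  interpret load_game K C
  proof
    fix n h and k :: "real^'h" assume "k \<in> K n"
    then obtain y where y: "y \<in> strategy_set A E lo hi n" "k = strategy_load A n y"
      by (auto simp: K_def)
    then have "0 \<le> y a h" if "a \<in> A n" for a
      using power_nonneg[OF that, of h] that y(1) by (auto simp: strategy_set_def intro: order_trans)
    then show "0 \<le> k $ h" by (simp add: y(2) strategy_load_def sum_nonneg)
  next
    fix L h assume "L \<in> load_profiles K" "period_load L h = 0"
    then show "C h 0 = 0" using zero_load by (auto simp: profiles)
  next
    fix L h assume "L \<in> load_profiles K" "0 < period_load L h"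
    then show "0 \<le> deriv (unit_price C h) (period_load L h)"
      using price_increasing by (auto simp: profiles)
  next
    fix n show "compact (K n)" "convex (K n)" "K n \<noteq> {}"
      using strategies_nonempty[of n]
      by (simp_all add: K_def compact_strategy_loads finite_appliances convex_strategy_loads)
  qed (fact cost_increasing cost_strictly_convex cost_differentiable)+
  have ex: "\<exists>x. nash_equilibrium A E lo hi C x"
    using ex_load_equilibrium profiles by (auto simp: nash_iff load_equilibrium_def)
  have unique_loads: "(\<exists>!L. \<exists>x. nash_equilibrium A E lo hi C x \<and> user_load A x = L) \<and>
      ((\<forall>n. card (A n) \<le> 1) \<longrightarrow> (\<exists>!x. nash_equilibrium A E lo hi C x))"
    if twice: "\<forall>h. \<forall>l>0. deriv (unit_price C h) differentiable (at l)"
      and steep: "\<forall>x\<in>profile_set A E lo hi. \<forall>h. 0 < total_load A x h \<longrightarrow>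
        deriv (unit_price C h) (total_load A x h) \<noteq> 0 \<and>
        (total_load A x h)\<^sup>2 / (\<Sum>n\<in>UNIV. (user_load A x n h)\<^sup>2) >
          (total_load A x h * deriv (deriv (unit_price C h)) (total_load A x h)
             / (2 * deriv (unit_price C h) (total_load A x h)))\<^sup>2"
  proof -
    have same_loads: "user_load A x = user_load A y"
      if "nash_equilibrium A E lo hi C x" "nash_equilibrium A E lo hi C y" for x y
    proof -
      have "profile_load A x = profile_load A y"
      proof (rule load_equilibrium_unique)
        fix L h assume "L \<in> load_profiles K" and pos: "0 < period_load L h"
        then obtain z where "z \<in> profile_set A E lo hi" "L = profile_load A z"
          by (auto simp: profiles)
        with steep pos show "deriv (unit_price C h) (period_load L h) \<noteq> 0"
          "(period_load L h * deriv (deriv (unit_price C h)) (period_load L h)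
              / (2 * deriv (unit_price C h) (period_load L h)))\<^sup>2
            < (period_load L h)\<^sup>2 / (\<Sum>n\<in>UNIV. (L $ n $ h)\<^sup>2)"
          by simp_all
      qed (use twice that in \<open>simp_all add: nash_iff\<close>)
      then show ?thesis by (simp add: profile_load_eq_iff)
    qed
    moreover have "x = y" if "\<forall>n. card (A n) \<le> 1"
      "nash_equilibrium A E lo hi C x" "nash_equilibrium A E lo hi C y" for x y
      using that same_loads[OF that(2,3)] finite_appliances
      by (intro profile_determined_by_loads[of A x E lo hi y]) (auto simp: nash_iff)
    ultimately show ?thesis using ex by blast
  qed
  show ?thesis
    by (rule conjI[OF ex], rule impI, elim conjE, rule unique_loads)
qed

end
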